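(* Let $d\geqslant 1$ and $k\in\mathbb N_0$ be integers, let $\Omega\subset\mathbb R^d$ be a bounded open polyhedral set, $\mathcal T$ a conforming simplicial mesh of $\Omega$, and $\mathbb E$ a finite-dimensional real vector space with $m=\dim\mathbb E\geqslant1$, identified with $\mathbb R^m$ through a fixed basis. Set $M=\binom{d+k}{d}$. Then $\mathrm{NN}_d^m(k;2H_{\mathcal T},MN_{\mathcal S})$ realizes $\widehat{\mathcal V}_k^{\mathrm{DG}}(\mathcal T;\mathbb E)$ pointwise on $\overline\Omega$: every $\boldsymbol v\in\widehat{\mathcal V}_k^{\mathrm{DG}}(\mathcal T;\mathbb E)$ agrees at every point of $\overline\Omega$ with some member of $\mathrm{NN}_d^m(k;2H_{\mathcal T},MN_{\mathcal S})$. For fixed $d$ and $k$, the hidden parameters $\boldsymbol W_{\mathrm I},\boldsymbol b_{\mathrm I},\boldsymbol W_{\mathrm{II},0},\boldsymbol W_{\mathrm{II},1},\boldsymbol b_{\mathrm{II}}$ depend only on the mesh and a fixed choice of an incident element for each subsimplex; only the output coefficients $\boldsymbol W_{\mathrm{III}}$ vary with the represented function. Moreover, $MN_{\mathcal S}\leqslant M(2^{d+1}-1)N_{\mathcal T}$.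
   Context: Mesh. $\Omega\subset\mathbb R^d$ is a bounded open polyhedral set, not necessarily convex or connected. A conforming simplicial mesh $\mathcal T=\{\tau_1,\dots,\tau_{N_{\mathcal T}}\}$ of $\Omega$ is a finite collection of pairwise disjoint open $d$-simplices $\tau_i\subset\Omega$ (elements) with $\bigcup_{\tau\in\mathcal T}\overline\tau=\overline\Omega$ such that for $i\neq j$ the set $\overline\tau_i\cap\overline\tau_j$ is either empty or a common subsimplex (face) of both. $N_{\mathcal T}$ is the number of elements. $H_{\mathcal T}$ is the number of distinct unoriented affine hyperplanes supporting the $(d-1)$-dimensional facets of elements (coplanar facets contribute only once). $\mathcal S_{\mathcal T}$ is the collection of all distinct relatively open nonempty subsimplices of the mesh (of all dimensions $0,\dots,d$, including the open elements and the vertices), and $N_{\mathcal S}=|\mathcal S_{\mathcal T}|$. An incident element of $\sigma\in\mathcal S_{\mathcal T}$ is an element $\tau\in\mathcal T$ with $\sigma\subset\overline\tau$. Function space. $\mathbb P_k(\mathbb R^d;\mathbb E)$ denotes the $\mathbb E$-valued polynomials of total degree at most $k$ on $\mathbb R^d$. $\widehat{\mathcal V}_k^{\mathrm{DG}}(\mathcal T;\mathbb E)$ is the space of functions $\boldsymbol v:\overline\Omega\to\mathbb E$ such that for every $\sigma\in\mathcal S_{\mathcal T}$ the restriction $\boldsymbol v|_\sigma$ is the restriction to $\sigma$ of an element of $\mathbb P_k(\mathbb R^d;\mathbb E)$; no compatibility is imposed between distinct relatively open subsimplices. Networks. $\varrho_0(t)=\mathbf 1_{\{t>0\}}$ and $\varrho_j(t)=(\max\{t,0\})^j$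 for $j\geqslant1$, applied componentwise to vectors. For positive integers $d,m,n_1,n_2$ and $k\in\mathbb N_0$, $\mathrm{NN}_d^m(k;n_1,n_2)$ is the class of functions $\mathbb R^d\to\mathbb R^m$ of the form $$\boldsymbol x\mapsto\boldsymbol W_{\mathrm{III}}\,\varrho_k\big(\boldsymbol W_{\mathrm{II},0}\varrho_0(\boldsymbol W_{\mathrm I}\boldsymbol x+\boldsymbol b_{\mathrm I})+\boldsymbol W_{\mathrm{II},1}\varrho_1(\boldsymbol W_{\mathrm I}\boldsymbol x+\boldsymbol b_{\mathrm I})+\boldsymbol b_{\mathrm{II}}\big)$$ with $\boldsymbol W_{\mathrm I}\in\mathbb R^{n_1\times d}$, $\boldsymbol b_{\mathrm I}\in\mathbb R^{n_1}$, $\boldsymbol W_{\mathrm{II},0},\boldsymbol W_{\mathrm{II},1}\in\mathbb R^{n_2\times n_1}$, $\boldsymbol b_{\mathrm{II}}\in\mathbb R^{n_2}$, $\boldsymbol W_{\mathrm{III}}\in\mathbb R^{m\times n_2}$. All parameters other than $\boldsymbol W_{\mathrm{III}}$ are called hidden parameters; the entries of $\boldsymbol W_{\mathrm{III}}$ are the output coefficients. The dependence statement means the hidden parameters can be chosen once, before $\boldsymbol v$, with only $\boldsymbol W_{\mathrm{III}}$ depending on $\boldsymbol v$. *)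

theory Defs
  imports "HOL-Analysis.Analysis"
begin

section \<open>Conforming simplicial meshes\<close>

text \<open>The set need be neither convex nor connected, so the library notion \<^const>\<open>polyhedron\<close>, which
  implies convexity, does not apply.\<close>

definition bounded_open_polyhedral :: "(real ^ 'd) set \<Rightarrow> bool" where
  "bounded_open_polyhedral \<Omega> \<longleftrightarrow> bounded \<Omega> \<and> open \<Omega> \<and>
     (\<exists>\<P>. finite \<P> \<and> (\<forall>P\<in>\<P>. polytope P) \<and> closure \<Omega> = \<Union>\<P>)"

definition open_simplex :: "(real ^ 'd) set \<Rightarrow> bool" where
  "open_simplex \<tau> \<longleftrightarrow> (\<exists>K. int CARD('d) simplex K \<and> \<tau> = interior K)"

text \<open>The faces (\<^const>\<open>face_of\<close>) of a closed simplex are exactly the convex hulls of subsets of its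
  vertex set; the empty set counts as a face.\<close>

definition conforming_mesh :: "(real ^ 'd) set set \<Rightarrow> (real ^ 'd) set \<Rightarrow> bool" where
  "conforming_mesh \<T> \<Omega> \<longleftrightarrow>
     finite \<T> \<and>
     (\<forall>\<tau>\<in>\<T>. open_simplex \<tau> \<and> \<tau> \<subseteq> \<Omega>) \<and>
     pairwise disjnt \<T> \<and>
     (\<Union>\<tau>\<in>\<T>. closure \<tau>) = closure \<Omega> \<and>
     (\<forall>\<tau>\<in>\<T>. \<forall>\<tau>'\<in>\<T>. \<tau> \<noteq> \<tau>' \<longrightarrow>
        closure \<tau> \<inter> closure \<tau>' = {} \<or>
        (closure \<tau> \<inter> closure \<tau>') face_of closure \<tau> \<and>
        (closure \<tau> \<inter> closure \<tau>') face_of closure \<tau>')"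

definition facet_hyperplanes :: "(real ^ 'd) set set \<Rightarrow> (real ^ 'd) set set" where
  "facet_hyperplanes \<T> = {affine hull F | F \<tau>. \<tau> \<in> \<T> \<and> F facet_of closure \<tau>}"

definition subsimplices :: "(real ^ 'd) set set \<Rightarrow> (real ^ 'd) set set" where
  "subsimplices \<T> = {rel_interior F | F \<tau>. \<tau> \<in> \<T> \<and> F face_of closure \<tau> \<and> F \<noteq> {}}"

definition incident_choice ::
  "(real ^ 'd) set set \<Rightarrow> ((real ^ 'd) set \<Rightarrow> (real ^ 'd) set) \<Rightarrow> bool" where
  "incident_choice \<T> \<iota> \<longleftrightarrow> (\<forall>\<sigma>\<in>subsimplices \<T>. \<iota> \<sigma> \<in> \<T> \<and> \<sigma> \<subseteq> closure (\<iota> \<sigma>))"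


section \<open>Fully discontinuous piecewise polynomials\<close>

text \<open>The finite-dimensional space \<open>E\<close> is a subset of a real vector space type, given with a basis
  \<open>b 0, \<dots>, b (m - 1)\<close>.\<close>

definition is_basis :: "nat \<Rightarrow> (nat \<Rightarrow> 'e::real_vector) \<Rightarrow> 'e set \<Rightarrow> bool" where
  "is_basis m b E \<longleftrightarrow> inj_on b {..<m} \<and> independent (b ` {..<m}) \<and> span (b ` {..<m}) = E"

definition polys :: "nat \<Rightarrow> 'e::real_vector set \<Rightarrow> (real ^ 'd \<Rightarrow> 'e) set" where
  "polys k E = {p. \<exists>c. (\<forall>\<alpha>. c \<alpha> \<in> E) \<and>
     p = (\<lambda>x. \<Sum>\<alpha> | (\<Sum>i\<in>UNIV. \<alpha> i) \<le> k. (\<Prod>i\<in>UNIV. x $ i ^ \<alpha> i) *\<^sub>R c \<alpha>)}"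

text \<open>Functions on \<open>closure \<Omega>\<close> are represented by total functions whose values elsewhere are
  unconstrained. Since \<open>closure \<Omega>\<close> is the union of the relatively open subsimplices, such a function
  automatically maps \<open>closure \<Omega>\<close> into \<open>E\<close>.\<close>

definition DG_space ::
  "nat \<Rightarrow> (real ^ 'd) set set \<Rightarrow> 'e::real_vector set \<Rightarrow> (real ^ 'd \<Rightarrow> 'e) set" where
  "DG_space k \<T> E = {v. \<forall>\<sigma>\<in>subsimplices \<T>. \<exists>p\<in>polys k E. \<forall>x\<in>\<sigma>. v x = p x}"


section \<open>Networks\<close>

definition rho :: "nat \<Rightarrow> real \<Rightarrow> real" where
  "rho j t = (if j = 0 then (if t > 0 then 1 else 0) else (max t 0) ^ j)"

text \<open>Since the widths depend on the mesh, vectors and matrices with such dimensions are functions on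
  \<^typ>\<open>nat\<close>, of which only the entries below the widths are used. The rows of the first weight matrix
  are vectors in \<^typ>\<open>real ^ 'd\<close>.\<close>

definition first_preact ::
  "(nat \<Rightarrow> real ^ 'd) \<Rightarrow> (nat \<Rightarrow> real) \<Rightarrow> real ^ 'd \<Rightarrow> nat \<Rightarrow> real" where
  "first_preact W\<^sub>I b\<^sub>I x l = W\<^sub>I l \<bullet> x + b\<^sub>I l"

definition second_preact ::
  "nat \<Rightarrow> (nat \<Rightarrow> real ^ 'd) \<Rightarrow> (nat \<Rightarrow> real) \<Rightarrow> (nat \<Rightarrow> nat \<Rightarrow> real) \<Rightarrow> (nat \<Rightarrow> nat \<Rightarrow> real) \<Rightarrow>
   (nat \<Rightarrow> real) \<Rightarrow> real ^ 'd \<Rightarrow> nat \<Rightarrow> real" where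
  "second_preact n\<^sub>1 W\<^sub>I b\<^sub>I W\<^sub>0 W\<^sub>1 b\<^sub>I\<^sub>I x j =
     (\<Sum>l<n\<^sub>1. W\<^sub>0 j l * rho 0 (first_preact W\<^sub>I b\<^sub>I x l)) +
     (\<Sum>l<n\<^sub>1. W\<^sub>1 j l * rho 1 (first_preact W\<^sub>I b\<^sub>I x l)) + b\<^sub>I\<^sub>I j"

text \<open>An element of $R^m$ is a function on \<^typ>\<open>nat\<close> vanishing outside \<open>{..<m}\<close>.\<close>

definition network ::
  "nat \<Rightarrow> nat \<Rightarrow> nat \<Rightarrow> nat \<Rightarrow> (nat \<Rightarrow> real ^ 'd) \<Rightarrow> (nat \<Rightarrow> real) \<Rightarrow> (nat \<Rightarrow> nat \<Rightarrow> real) \<Rightarrow>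
   (nat \<Rightarrow> nat \<Rightarrow> real) \<Rightarrow> (nat \<Rightarrow> real) \<Rightarrow> (nat \<Rightarrow> nat \<Rightarrow> real) \<Rightarrow> real ^ 'd \<Rightarrow> nat \<Rightarrow> real" where
  "network m k n\<^sub>1 n\<^sub>2 W\<^sub>I b\<^sub>I W\<^sub>0 W\<^sub>1 b\<^sub>I\<^sub>I W\<^sub>I\<^sub>I\<^sub>I x i =
     (if i < m then \<Sum>j<n\<^sub>2. W\<^sub>I\<^sub>I\<^sub>I i j * rho k (second_preact n\<^sub>1 W\<^sub>I b\<^sub>I W\<^sub>0 W\<^sub>1 b\<^sub>I\<^sub>I x j) else 0)"

definition NN :: "nat \<Rightarrow> nat \<Rightarrow> nat \<Rightarrow> nat \<Rightarrow> (real ^ 'd \<Rightarrow> nat \<Rightarrow> real) set" where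
  "NN m k n\<^sub>1 n\<^sub>2 = {network m k n\<^sub>1 n\<^sub>2 W\<^sub>I b\<^sub>I W\<^sub>0 W\<^sub>1 b\<^sub>I\<^sub>I W\<^sub>I\<^sub>I\<^sub>I | W\<^sub>I b\<^sub>I W\<^sub>0 W\<^sub>1 b\<^sub>I\<^sub>I W\<^sub>I\<^sub>I\<^sub>I. True}"

text \<open>The identification of $R^m$ with \<open>E\<close> through the basis \<open>b\<close>.\<close>

definition of_coords :: "nat \<Rightarrow> (nat \<Rightarrow> 'e::real_vector) \<Rightarrow> (nat \<Rightarrow> real) \<Rightarrow> 'e" where
  "of_coords m b y = (\<Sum>i<m. y i *\<^sub>R b i)"

end

theory Submission
  imports Defs
begin

text \<open>A piecewise polynomial is the sum, over the cells $\sigma$ of the mesh, of its polynomial piece times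
  the indicator of $\sigma$. The points of the closed domain lie in exactly one cell each
  (\<open>subsimplices_cover\<close>, and \<open>subsimplices_disjoint\<close>, where conformity is used). It is therefore
  enough to produce, for every cell, $M$ neurons whose outputs span the
  polynomials of degree at most $k$ on $\sigma$ and vanish on the other cells.

  The outputs on $\sigma$ are $k$-th powers of affine forms. With $\varepsilon > 0$ small, the forms
  $L_\beta(x) = 1 + \varepsilon\,\beta\cdot x$ for multi-indices $|\beta| \le k$ are positive on the
  bounded domain, and there are $M$ of them. By \<open>monomial_in_span_powers\<close> their $k$-th powers span all
  polynomials of degree at most $k$, and neither the forms nor this fact refer to the function to be
  represented.

  To confine such a power to $\sigma$, describe the cell by the barycentric coordinates of an incident
  simplex: some are positive and the others are zero (\<open>rel_interior_face_barycentric\<close>). Each coordinate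
  is a multiple of the affine form of a facet hyperplane, so these sign conditions can be tested with
  Heaviside units applied to the two orientations of each hyperplane. That explains the width $2H$.
  The number $V$ of violated conditions vanishes on $\sigma$ and is at least $1$ off $\sigma$, and
  $L_\beta$ is itself a combination of first-layer outputs (\<open>cell_neurons\<close>). A second-layer neuron
  with input $L_\beta - 2V$ then outputs $L_\beta^k$ on $\sigma$ and $0$ on the other cells, because
  $0 < L_\beta \le 2$. Nothing in this construction involves the represented function except the
  output coefficients.\<close>

section \<open>Powers of affine forms span the polynomials\<close>

definition multi_indices :: "nat \<Rightarrow> ('d::finite \<Rightarrow> nat) set" where
  "multi_indices k = {\<alpha>. (\<Sum>i\<in>UNIV. \<alpha> i) \<le> k}"

text \<open>A multi-index of degree at most $k$ is a composition of $k$ into $d+1$ natural numbers, the extra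
  part being the slack.\<close>
lemma card_multi_indices:
  "finite (multi_indices k :: ('d::finite \<Rightarrow> nat) set)"
  "card (multi_indices k :: ('d \<Rightarrow> nat) set) = (CARD('d) + k) choose CARD('d)"
proof -
  obtain ds :: "'d list" where ds: "set ds = UNIV" "distinct ds"
    using finite_distinct_list[of "UNIV :: 'd set"] by auto
  have len: "length ds = CARD('d)"
    using distinct_card[OF ds(2)] ds(1) by simp
  have sum_ds: "sum_list (map \<alpha> ds) = (\<Sum>i\<in>UNIV. \<alpha> i)" for \<alpha> :: "'d \<Rightarrow> nat"
    using sum_list_distinct_conv_sum_set[OF ds(2), of \<alpha>] ds(1) by simp
  define f where "f = (\<lambda>\<alpha>. (k - (\<Sum>i\<in>UNIV. \<alpha> i)) # map \<alpha> ds)"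
  let ?L = "{l::nat list. length l = CARD('d) + 1 \<and> sum_list l = k}"
  have inj: "inj_on f (multi_indices k)"
    using ds(1) by (auto simp: inj_on_def f_def fun_eq_iff)
  have "f ` multi_indices k = ?L"
  proof (intro equalityI subsetI)
    fix l assume l: "l \<in> ?L"
    then obtain s l' where l': "l = s # l'"
      by (cases l) auto
    define \<alpha> where "\<alpha> = (\<lambda>i. the (map_of (zip ds l') i))"
    have m: "map \<alpha> ds = l'"
      using l l' len ds(2)
      by (intro nth_equalityI) (auto simp: \<alpha>_def map_of_zip_nth)
    then have "\<alpha> \<in> multi_indices k" "f \<alpha> = l"
      using l l' sum_ds[of \<alpha>] by (auto simp: f_def multi_indices_def)
    then show "l \<in> f ` multi_indices k" by blast
  qed (auto simp: f_def multi_indices_def sum_ds len)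
  then have bij: "bij_betw f (multi_indices k) ?L"
    using inj by (simp add: bij_betw_def)
  have "?L \<subseteq> {l. set l \<subseteq> {..k} \<and> length l = CARD('d) + 1}"
    using member_le_sum_list by fastforce
  then have "finite ?L"
    using finite_lists_length_eq[of "{..k}" "CARD('d) + 1"] by (rule finite_subset) simp
  then show "finite (multi_indices k :: ('d \<Rightarrow> nat) set)"
    using bij_betw_finite[OF bij] by simp
  show "card (multi_indices k :: ('d \<Rightarrow> nat) set) = (CARD('d) + k) choose CARD('d)"
    using bij_betw_same_card[OF bij] card_length_sum_list[of "CARD('d) + 1" k]
      binomial_symmetric[of k "CARD('d) + k"]
    by (simp add: add.commute)
qed

lemma prod_power_upd:
  fixes z :: "'d::finite \<Rightarrow> real"
  shows "(\<Prod>j\<in>UNIV. z j ^ (\<gamma>(i := Suc (\<gamma> i))) j) = z i * (\<Prod>j\<in>UNIV. z j ^ \<gamma> j)"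
proof -
  have "(\<Prod>j\<in>UNIV. z j ^ (\<gamma>(i := Suc (\<gamma> i))) j) = (\<Prod>j\<in>UNIV. (if j = i then z i else 1) * z j ^ \<gamma> j)"
    by (rule prod.cong) auto
  then show ?thesis by (simp add: prod.distrib)
qed

lemma sum_upd_Suc:
  fixes \<gamma> :: "'d::finite \<Rightarrow> nat"
  shows "(\<Sum>j\<in>UNIV. (\<gamma>(i := Suc (\<gamma> i))) j) = Suc (\<Sum>j\<in>UNIV. \<gamma> j)"
proof -
  have "(\<Sum>j\<in>UNIV. (\<gamma>(i := Suc (\<gamma> i))) j) = (\<Sum>j\<in>UNIV. (if j = i then 1 else 0) + \<gamma> j)"
    by (rule sum.cong) auto
  then show ?thesis by (simp add: sum.distrib)
qed

lemma sum_upd_pred: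
  fixes \<gamma> :: "'d::finite \<Rightarrow> nat"
  assumes "\<gamma> i > 0"
  shows "Suc (\<Sum>j\<in>UNIV. (\<gamma>(i := \<gamma> i - 1)) j) = (\<Sum>j\<in>UNIV. \<gamma> j)"
  using sum_upd_Suc[of "\<gamma>(i := \<gamma> i - 1)" i] assms by simp

text \<open>The multinomial theorem with unspecified coefficients: the elimination below only needs that
  none of them vanishes. Positivity is what survives the induction, since multiplying by
  $1 + \sum_i z_i$ adds coefficients and never cancels them.\<close>
lemma power_affine_expansion:
  "\<exists>m. (\<forall>\<gamma>\<in>multi_indices k. m \<gamma> > 0) \<and>
     (\<forall>z :: 'd::finite \<Rightarrow> real.
        (1 + (\<Sum>i\<in>UNIV. z i)) ^ k = (\<Sum>\<gamma>\<in>multi_indices k. m \<gamma> * (\<Prod>i\<in>UNIV. z i ^ \<gamma> i)))"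
proof (induction k)
  case 0
  have "multi_indices 0 = {\<lambda>i::'d. 0}"
    by (auto simp: multi_indices_def fun_eq_iff)
  then show ?case
    by (intro exI[of _ "\<lambda>_. 1"]) simp
next
  case (Suc k)
  let ?A = "multi_indices :: nat \<Rightarrow> ('d \<Rightarrow> nat) set"
  let ?z = "\<lambda>(z :: 'd \<Rightarrow> real) \<gamma>. \<Prod>i\<in>UNIV. z i ^ \<gamma> i"
  obtain m where pos: "\<And>\<gamma>. \<gamma> \<in> ?A k \<Longrightarrow> m \<gamma> > 0"
    and m: "\<And>z :: 'd \<Rightarrow> real. (1 + (\<Sum>i\<in>UNIV. z i)) ^ k = (\<Sum>\<gamma>\<in>?A k. m \<gamma> * ?z z \<gamma>)"
    using Suc by blast
  \<comment> \<open>The coefficients contributed by the summand $1$ and by the summand $z_i$ of the extra factor.\<close>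
  define m0 where "m0 = (\<lambda>\<gamma>. if \<gamma> \<in> ?A k then m \<gamma> else 0)"
  define mi where "mi = (\<lambda>i \<gamma>. if \<gamma> i > 0 then m (\<gamma>(i := \<gamma> i - 1)) else 0)"
  define m' where "m' = (\<lambda>\<gamma>. m0 \<gamma> + (\<Sum>i\<in>UNIV. mi i \<gamma>))"
  have pred: "\<gamma>(i := \<gamma> i - 1) \<in> ?A k" if "\<gamma> \<in> ?A (Suc k)" "\<gamma> i > 0" for i \<gamma>
    using that sum_upd_pred[of \<gamma> i] by (simp add: multi_indices_def)
  have mi_nonneg: "mi i \<gamma> \<ge> 0" if "\<gamma> \<in> ?A (Suc k)" for i \<gamma>
    using pos[OF pred[OF that]] by (simp add: mi_def less_imp_le)
  have "m' \<gamma> > 0" if \<gamma>: "\<gamma> \<in> ?A (Suc k)" for \<gamma>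
  proof (cases "\<gamma> \<in> ?A k")
    case True
    then show ?thesis
      using pos sum_nonneg[of UNIV "\<lambda>i. mi i \<gamma>"] mi_nonneg[OF \<gamma>]
      by (simp add: m'_def m0_def add_pos_nonneg)
  next
    case False
    then have "\<exists>i. \<gamma> i > 0" by (rule contrapos_np) (simp add: multi_indices_def)
    then obtain i where i: "\<gamma> i > 0" ..
    then have "mi i \<gamma> > 0" using pos pred[OF \<gamma> i] by (simp add: mi_def)
    then have "(\<Sum>i\<in>UNIV. mi i \<gamma>) > 0"
      using mi_nonneg[OF \<gamma>] by (intro sum_pos2[of _ i]) auto
    then show ?thesis using False by (simp add: m'_def m0_def)
  qed
  moreover have "(1 + (\<Sum>i\<in>UNIV. z i)) ^ Suc k = (\<Sum>\<gamma>\<in>?A (Suc k). m' \<gamma> * ?z z \<gamma>)"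
    for z :: "'d \<Rightarrow> real"
  proof -
    have sub: "?A k \<subseteq> ?A (Suc k)" by (auto simp: multi_indices_def)
    have s0: "(\<Sum>\<gamma>\<in>?A k. m \<gamma> * ?z z \<gamma>) = (\<Sum>\<gamma>\<in>?A (Suc k). m0 \<gamma> * ?z z \<gamma>)"
      using sub card_multi_indices(1)
      by (intro sum.mono_neutral_cong_left) (auto simp: m0_def)
    have si: "z i * (\<Sum>\<gamma>\<in>?A k. m \<gamma> * ?z z \<gamma>) = (\<Sum>\<gamma>\<in>?A (Suc k). mi i \<gamma> * ?z z \<gamma>)" for i
    proof -
      have "z i * (\<Sum>\<gamma>\<in>?A k. m \<gamma> * ?z z \<gamma>) = (\<Sum>\<gamma>\<in>?A k. m \<gamma> * (z i * ?z z \<gamma>))"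
        by (simp add: sum_distrib_left mult_ac)
      also have "\<dots> = (\<Sum>\<gamma>\<in>{\<gamma>\<in>?A (Suc k). \<gamma> i > 0}. mi i \<gamma> * ?z z \<gamma>)"
      proof (rule sum.reindex_bij_witness[where i = "\<lambda>\<gamma>. \<gamma>(i := \<gamma> i - 1)" and j = "\<lambda>\<gamma>. \<gamma>(i := Suc (\<gamma> i))"])
        fix \<gamma> assume "\<gamma> \<in> ?A k"
        then show "\<gamma>(i := Suc (\<gamma> i)) \<in> {\<gamma> \<in> ?A (Suc k). \<gamma> i > 0}"
          using sum_upd_Suc[of \<gamma> i] by (simp add: multi_indices_def)
        show "mi i (\<gamma>(i := Suc (\<gamma> i))) * ?z z (\<gamma>(i := Suc (\<gamma> i))) = m \<gamma> * (z i * ?z z \<gamma>)"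
          unfolding prod_power_upd by (simp add: mi_def)
      qed (use pred in \<open>auto simp: fun_upd_idem\<close>)
      also have "\<dots> = (\<Sum>\<gamma>\<in>?A (Suc k). mi i \<gamma> * ?z z \<gamma>)"
        using card_multi_indices(1) by (intro sum.mono_neutral_left) (auto simp: mi_def)
      finally show ?thesis .
    qed
    have "(1 + (\<Sum>i\<in>UNIV. z i)) ^ Suc k =
        (\<Sum>\<gamma>\<in>?A k. m \<gamma> * ?z z \<gamma>) + (\<Sum>i\<in>UNIV. z i * (\<Sum>\<gamma>\<in>?A k. m \<gamma> * ?z z \<gamma>))"
      by (simp add: m distrib_right sum_distrib_right)
    also have "\<dots> = (\<Sum>\<gamma>\<in>?A (Suc k). m0 \<gamma> * ?z z \<gamma>) +
        (\<Sum>\<gamma>\<in>?A (Suc k). \<Sum>i\<in>UNIV. mi i \<gamma> * ?z z \<gamma>)"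
      unfolding s0[symmetric] si by (subst sum.swap) simp
    also have "\<dots> = (\<Sum>\<gamma>\<in>?A (Suc k). m' \<gamma> * ?z z \<gamma>)"
      by (simp add: m'_def distrib_right sum_distrib_right sum.distrib)
    finally show ?thesis .
  qed
  ultimately show ?case by blast
qed

text \<open>Up to normalization these are the weights of the $g$-th finite difference: it annihilates powers
  below $g$ but not the $g$-th power. They are obtained by differencing the weights of order
  $g - 1$, which lowers the degree by one.\<close>
lemma difference_weights:
  "\<exists>D :: nat \<Rightarrow> real. (\<forall>a<g. (\<Sum>n\<le>g. D n * real n ^ a) = 0) \<and> (\<Sum>n\<le>g. D n * real n ^ g) \<noteq> 0"
proof (induction g)
  case 0
  show ?case by (intro exI[of _ "\<lambda>_. 1"]) simp
next
  case (Suc g)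
  then obtain D :: "nat \<Rightarrow> real" where D0: "\<And>a. a < g \<Longrightarrow> (\<Sum>n\<le>g. D n * real n ^ a) = 0"
    and Dg: "(\<Sum>n\<le>g. D n * real n ^ g) \<noteq> 0" by blast
  \<comment> \<open>The difference of \<open>D\<close> shifted by one and \<open>D\<close>: it maps $p$ to $\sum_n D(n)\,(p(n+1) - p(n))$.\<close>
  define D' where "D' = (\<lambda>n. (if n = 0 then 0 else D (n - 1)) - (if n \<le> g then D n else 0))"
  have D': "(\<Sum>n\<le>Suc g. D' n * real n ^ a) = (\<Sum>l<a. real (a choose l) * (\<Sum>n\<le>g. D n * real n ^ l))" for a
  proof -
    have "(\<Sum>n\<le>Suc g. D' n * real n ^ a) =
      (\<Sum>n\<le>Suc g. (if n = 0 then 0 else D (n - 1)) * real n ^ a) - (\<Sum>n\<le>Suc g. (if n \<le> g then D n else 0) * real n ^ a)"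
      by (simp add: D'_def left_diff_distrib sum_subtractf)
    also have "(\<Sum>n\<le>Suc g. (if n = 0 then 0 else D (n - 1)) * real n ^ a) = (\<Sum>n\<le>g. D n * real (Suc n) ^ a)"
      by (subst sum.atMost_Suc_shift) simp
    also have "(\<Sum>n\<le>Suc g. (if n \<le> g then D n else 0) * real n ^ a) = (\<Sum>n\<le>g. D n * real n ^ a)"
      by simp
    also have "(\<Sum>n\<le>g. D n * real (Suc n) ^ a) - (\<Sum>n\<le>g. D n * real n ^ a) =
       (\<Sum>n\<le>g. D n * (real (Suc n) ^ a - real n ^ a))"
      by (simp add: sum_subtractf right_diff_distrib)
    also have "\<dots> = (\<Sum>n\<le>g. D n * (\<Sum>l<a. real (a choose l) * real n ^ l))"
    proof (intro sum.cong refl arg_cong[where f = "(*) _"])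
      fix n
      have "real (Suc n) ^ a = (real n + 1) ^ a" by (simp add: add.commute)
      also have "\<dots> = (\<Sum>l\<le>a. real (a choose l) * real n ^ l)"
        by (simp add: binomial_ring)
      finally show "real (Suc n) ^ a - real n ^ a = (\<Sum>l<a. real (a choose l) * real n ^ l)"
        by (simp flip: lessThan_Suc_atMost)
    qed
    also have "\<dots> = (\<Sum>l<a. real (a choose l) * (\<Sum>n\<le>g. D n * real n ^ l))"
      by (simp add: sum_distrib_left mult_ac, subst sum.swap, simp)
    finally show ?thesis .
  qed
  have "(\<Sum>n\<le>Suc g. D' n * real n ^ a) = 0" if "a < Suc g" for a
    unfolding D' using that D0 by (intro sum.neutral) auto
  moreover have "(\<Sum>n\<le>Suc g. D' n * real n ^ Suc g) \<noteq> 0"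
    unfolding D' using D0 Dg by simp
  ultimately show ?case by blast
qed

text \<open>The $k$-th powers of the forms $1 + \beta\cdot z$, with $\beta$ in the lattice simplex
  $|\beta| \le k$, are exactly as many as the monomials of degree at most $k$, and they span them.
  Taking the $\alpha$-th mixed finite difference in $\beta$ of $(1 + \beta\cdot z)^k$ stays inside the
  lattice and removes from the multinomial expansion all monomials $z^\gamma$ except those with
  $\gamma \ge \alpha$ componentwise, keeping $z^\alpha$ itself. The system is triangular, so it is
  solved by induction from the highest degree downwards.\<close>
lemma monomial_in_span_powers:
  fixes \<alpha> :: "'d::finite \<Rightarrow> nat"
  assumes "\<alpha> \<in> multi_indices k"
  shows "\<exists>w. \<forall>z :: 'd \<Rightarrow> real. (\<Prod>i\<in>UNIV. z i ^ \<alpha> i) =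
     (\<Sum>\<beta>\<in>multi_indices k. w \<beta> * (1 + (\<Sum>i\<in>UNIV. real (\<beta> i) * z i)) ^ k)"
  using assms
proof (induction \<alpha> rule: measure_induct_rule[where f = "\<lambda>\<alpha>. k - (\<Sum>i\<in>UNIV. \<alpha> i)"])
  case (less \<alpha>)
  let ?A = "multi_indices k :: ('d \<Rightarrow> nat) set"
  let ?z = "\<lambda>(z :: 'd \<Rightarrow> real) \<gamma>. \<Prod>i\<in>UNIV. z i ^ \<gamma> i"
  let ?p = "\<lambda>(z :: 'd \<Rightarrow> real) \<beta>. (1 + (\<Sum>i\<in>UNIV. real (\<beta> i) * z i)) ^ k"
  note fin = card_multi_indices(1)[of k, where 'd = 'd]
  obtain m where pos: "\<And>\<gamma>. \<gamma> \<in> ?A \<Longrightarrow> m \<gamma> > 0"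
    and m: "\<And>z :: 'd \<Rightarrow> real. (1 + (\<Sum>i\<in>UNIV. z i)) ^ k = (\<Sum>\<gamma>\<in>?A. m \<gamma> * ?z z \<gamma>)"
    using power_affine_expansion[of k] by blast
  obtain D :: "nat \<Rightarrow> nat \<Rightarrow> real"
    where D0: "\<And>g a. a < g \<Longrightarrow> (\<Sum>n\<le>g. D g n * real n ^ a) = 0"
      and Dg: "\<And>g. (\<Sum>n\<le>g. D g n * real n ^ g) \<noteq> 0"
    using difference_weights by metis
  \<comment> \<open>The box below \<open>\<alpha>\<close>: the nodes used by the mixed difference of order \<open>\<alpha>\<close>, where sums of products
    factor into one-dimensional sums.\<close>
  define B where "B = PiE UNIV (\<lambda>i. {..\<alpha> i})"
  have B: "B \<subseteq> ?A"
  proof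
    fix \<beta> assume "\<beta> \<in> B"
    then have "(\<Sum>i\<in>UNIV. \<beta> i) \<le> (\<Sum>i\<in>UNIV. \<alpha> i)"
      by (intro sum_mono) (auto simp: B_def)
    then show "\<beta> \<in> ?A" using less.prems by (simp add: multi_indices_def)
  qed
  \<comment> \<open>The weights of the mixed difference, and the coefficient of $z^\gamma$ that it leaves.\<close>
  define \<Delta> where "\<Delta> = (\<lambda>\<beta>. \<Prod>i\<in>UNIV. D (\<alpha> i) (\<beta> i))"
  define c where "c = (\<lambda>\<gamma>. m \<gamma> * (\<Prod>i\<in>UNIV. \<Sum>n\<le>\<alpha> i. D (\<alpha> i) n * real n ^ \<gamma> i))"
  define G where "G = {\<gamma>\<in>?A. (\<forall>i. \<alpha> i \<le> \<gamma> i) \<and> \<gamma> \<noteq> \<alpha>}"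
  have c_zero: "c \<gamma> = 0" if "\<not> (\<forall>i. \<alpha> i \<le> \<gamma> i)" for \<gamma>
    using that D0 by (auto simp: c_def not_le)
  have c_nonzero: "c \<alpha> \<noteq> 0"
    using pos[OF less.prems] Dg by (simp add: c_def)
  have expand: "(\<Sum>\<beta>\<in>B. \<Delta> \<beta> * ?p z \<beta>) = c \<alpha> * ?z z \<alpha> + (\<Sum>\<gamma>\<in>G. c \<gamma> * ?z z \<gamma>)" for z
  proof -
    have "(\<Sum>\<beta>\<in>B. \<Delta> \<beta> * ?p z \<beta>) =
        (\<Sum>\<beta>\<in>B. \<Sum>\<gamma>\<in>?A. m \<gamma> * ?z z \<gamma> * (\<Prod>i\<in>UNIV. D (\<alpha> i) (\<beta> i) * real (\<beta> i) ^ \<gamma> i))"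
      by (simp add: m \<Delta>_def sum_distrib_left power_mult_distrib prod.distrib mult_ac)
    also have "\<dots> = (\<Sum>\<gamma>\<in>?A. m \<gamma> * ?z z \<gamma> * (\<Sum>\<beta>\<in>B. \<Prod>i\<in>UNIV. D (\<alpha> i) (\<beta> i) * real (\<beta> i) ^ \<gamma> i))"
      by (subst sum.swap) (simp add: sum_distrib_left)
    also have "\<dots> = (\<Sum>\<gamma>\<in>?A. c \<gamma> * ?z z \<gamma>)"
      by (simp add: c_def B_def prod_sum_PiE mult_ac)
    also have "\<dots> = (\<Sum>\<gamma>\<in>insert \<alpha> G. c \<gamma> * ?z z \<gamma>)"
      using less.prems fin c_zero by (intro sum.mono_neutral_right) (auto simp: G_def)
    also have "\<dots> = c \<alpha> * ?z z \<alpha> + (\<Sum>\<gamma>\<in>G. c \<gamma> * ?z z \<gamma>)"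
      using fin by (subst sum.insert) (auto simp: G_def)
    finally show ?thesis .
  qed
  have "\<exists>w. \<forall>z. ?z z \<gamma> = (\<Sum>\<beta>\<in>?A. w \<beta> * ?p z \<beta>)" if \<gamma>: "\<gamma> \<in> G" for \<gamma>
  proof (rule less.IH)
    obtain i where "\<gamma> i \<noteq> \<alpha> i" using \<gamma> by (auto simp: G_def fun_eq_iff)
    then have "\<alpha> i < \<gamma> i" using \<gamma> by (auto simp: G_def order.not_eq_order_implies_strict)
    then have "(\<Sum>i\<in>UNIV. \<alpha> i) < (\<Sum>i\<in>UNIV. \<gamma> i)"
      using \<gamma> by (intro sum_strict_mono_ex1) (auto simp: G_def)
    then show "k - (\<Sum>i\<in>UNIV. \<gamma> i) < k - (\<Sum>i\<in>UNIV. \<alpha> i)"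
      using \<gamma> by (auto simp: G_def multi_indices_def)
    show "\<gamma> \<in> ?A" using \<gamma> by (simp add: G_def)
  qed
  then have "\<forall>\<gamma>\<in>G. \<exists>w. \<forall>z. ?z z \<gamma> = (\<Sum>\<beta>\<in>?A. w \<beta> * ?p z \<beta>)" by (rule ballI)
  from bchoice[OF this] obtain w
    where w: "\<And>\<gamma> z. \<gamma> \<in> G \<Longrightarrow> ?z z \<gamma> = (\<Sum>\<beta>\<in>?A. w \<gamma> \<beta> * ?p z \<beta>)"
    by blast
  define w' where "w' = (\<lambda>\<beta>. ((if \<beta> \<in> B then \<Delta> \<beta> else 0) - (\<Sum>\<gamma>\<in>G. c \<gamma> * w \<gamma> \<beta>)) / c \<alpha>)"
  have "?z z \<alpha> = (\<Sum>\<beta>\<in>?A. w' \<beta> * ?p z \<beta>)" for z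
  proof -
    have "(\<Sum>\<gamma>\<in>G. c \<gamma> * ?z z \<gamma>) = (\<Sum>\<gamma>\<in>G. \<Sum>\<beta>\<in>?A. c \<gamma> * w \<gamma> \<beta> * ?p z \<beta>)"
      by (simp add: w sum_distrib_left mult_ac)
    also have "\<dots> = (\<Sum>\<beta>\<in>?A. (\<Sum>\<gamma>\<in>G. c \<gamma> * w \<gamma> \<beta>) * ?p z \<beta>)"
      by (subst sum.swap) (simp add: sum_distrib_right)
    finally have G: "(\<Sum>\<gamma>\<in>G. c \<gamma> * ?z z \<gamma>) = \<dots>" .
    have "(\<Sum>\<beta>\<in>B. \<Delta> \<beta> * ?p z \<beta>) = (\<Sum>\<beta>\<in>?A. (if \<beta> \<in> B then \<Delta> \<beta> else 0) * ?p z \<beta>)"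
      using B fin by (intro sum.mono_neutral_cong_left) auto
    then have "c \<alpha> * ?z z \<alpha> = (\<Sum>\<beta>\<in>?A. c \<alpha> * w' \<beta> * ?p z \<beta>)"
      using expand[of z] G c_nonzero by (simp add: w'_def left_diff_distrib sum_subtractf)
    then have "c \<alpha> * ?z z \<alpha> = c \<alpha> * (\<Sum>\<beta>\<in>?A. w' \<beta> * ?p z \<beta>)"
      by (simp add: sum_distrib_left mult.assoc)
    then show ?thesis using c_nonzero by simp
  qed
  then show ?case by blast
qed

section \<open>Cells of a simplex in barycentric coordinates\<close>

text \<open>When \<open>c\<close> is a vertex and $a_c\cdot x + b_c = 0$ is the hyperplane through the opposite facet, this
  is the barycentric coordinate of \<open>x\<close> at \<open>c\<close>. Keeping the equation of the facet explicit makes the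
  sign of the coordinate readable from a neuron that computes $a_c\cdot x + b_c$.\<close>
definition barycentric :: "('a \<Rightarrow> 'a) \<Rightarrow> ('a \<Rightarrow> real) \<Rightarrow> 'a \<Rightarrow> 'a::real_inner \<Rightarrow> real" where
  "barycentric a b c x = (a c \<bullet> x + b c) / (a c \<bullet> c + b c)"

lemma barycentric_coordinates:
  fixes C :: "'a::euclidean_space set"
  assumes ind: "\<not> affine_dependent C" and card: "card C = Suc (DIM('a))"
    and facet: "\<And>c. c \<in> C \<Longrightarrow> affine hull (C - {c}) = {x. a c \<bullet> x + b c = 0}"
  defines "u \<equiv> barycentric a b"
  shows barycentric_nonzero: "\<And>c. c \<in> C \<Longrightarrow> a c \<bullet> c + b c \<noteq> 0"
    and barycentric_unique:
      "\<And>v c. \<lbrakk>sum v C = 1; c \<in> C\<rbrakk> \<Longrightarrow> u c (\<Sum>c\<in>C. v c *\<^sub>R c) = v c"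
    and barycentric_sum: "\<And>x. (\<Sum>c\<in>C. u c x) = 1"
    and barycentric_combination: "\<And>x. (\<Sum>c\<in>C. u c x *\<^sub>R c) = x"
proof -
  have fin: "finite C" using ind by (rule aff_independent_finite)
  show nz: "a c \<bullet> c + b c \<noteq> 0" if "c \<in> C" for c
    using ind that facet[OF that] by (auto simp: affine_dependent_def)
  show uniq: "u c (\<Sum>c\<in>C. v c *\<^sub>R c) = v c" if v: "sum v C = 1" and c: "c \<in> C" for v c
  proof -
    have "a c \<bullet> (\<Sum>c\<in>C. v c *\<^sub>R c) + b c = (\<Sum>c'\<in>C. v c' * (a c \<bullet> c')) + (\<Sum>c'\<in>C. v c') * b c"
      using v by (simp add: inner_sum_right)
    also have "\<dots> = (\<Sum>c'\<in>C. v c' * (a c \<bullet> c' + b c))"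
      by (simp add: sum_distrib_right distrib_left sum.distrib)
    also have "\<dots> = (\<Sum>c'\<in>{c}. v c' * (a c \<bullet> c' + b c))"
    proof (intro sum.mono_neutral_right ballI)
      fix c' assume "c' \<in> C - {c}"
      then have "c' \<in> affine hull (C - {c})" by (rule hull_inc)
      then show "v c' * (a c \<bullet> c' + b c) = 0" using facet[OF c] by simp
    qed (use c fin in auto)
    finally show ?thesis using nz[OF c] by (simp add: u_def barycentric_def)
  qed
  have "\<forall>x. \<exists>v. sum v C = 1 \<and> (\<Sum>c\<in>C. v c *\<^sub>R c) = x"
    using affine_independent_span_eq[OF ind card] affine_hull_finite[OF fin] by blast
  from choice[OF this] obtain v where v: "\<And>x. sum (v x) C = 1" "\<And>x. (\<Sum>c\<in>C. v x c *\<^sub>R c) = x"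
    by blast
  have u: "u c x = v x c" if "c \<in> C" for c x
    using uniq[OF v(1)[of x] that] v(2)[of x] by simp
  then show "(\<Sum>c\<in>C. u c x) = 1" "(\<Sum>c\<in>C. u c x *\<^sub>R c) = x" for x
    using v by simp_all
qed

text \<open>A cell is cut out by sign conditions on the barycentric coordinates alone, in the whole space and
  not just inside the simplex. A network can therefore recognize it by testing these signs.\<close>
lemma rel_interior_face_barycentric:
  fixes C :: "'a::euclidean_space set"
  assumes ind: "\<not> affine_dependent C" and card: "card C = Suc (DIM('a))"
    and facet: "\<And>c. c \<in> C \<Longrightarrow> affine hull (C - {c}) = {x. a c \<bullet> x + b c = 0}"
    and D: "D \<subseteq> C"
  defines "u \<equiv> barycentric a b"
  shows "rel_interior (convex hull D) = {x. (\<forall>c\<in>D. u c x > 0) \<and> (\<forall>c\<in>C - D. u c x = 0)}"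
proof -
  note bary = barycentric_coordinates[OF ind card facet, folded u_def]
  have fin: "finite C" using ind by (rule aff_independent_finite)
  show ?thesis
    unfolding rel_interior_convex_hull_explicit[OF affine_independent_subset[OF ind D]]
  proof (intro equalityI subsetI)
    fix x assume "x \<in> {y. \<exists>v. (\<forall>c\<in>D. 0 < v c) \<and> sum v D = 1 \<and> (\<Sum>c\<in>D. v c *\<^sub>R c) = y}"
    then obtain v where v: "\<And>c. c \<in> D \<Longrightarrow> 0 < v c" "sum v D = 1" "(\<Sum>c\<in>D. v c *\<^sub>R c) = x"
      by blast
    define v' where "v' = (\<lambda>c. if c \<in> D then v c else 0)"
    have "sum v' C = sum v D" "(\<Sum>c\<in>C. v' c *\<^sub>R c) = (\<Sum>c\<in>D. v c *\<^sub>R c)"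
      using D fin by (auto simp: v'_def intro!: sum.mono_neutral_cong_right)
    then have "u c x = v' c" if "c \<in> C" for c
      using bary(2)[of v' c] that v by simp
    then show "x \<in> {x. (\<forall>c\<in>D. u c x > 0) \<and> (\<forall>c\<in>C - D. u c x = 0)}"
      using D v(1) by (auto simp: v'_def)
  next
    fix x assume x: "x \<in> {x. (\<forall>c\<in>D. u c x > 0) \<and> (\<forall>c\<in>C - D. u c x = 0)}"
    have "(\<Sum>c\<in>D. u c x) = (\<Sum>c\<in>C. u c x)" "(\<Sum>c\<in>D. u c x *\<^sub>R c) = (\<Sum>c\<in>C. u c x *\<^sub>R c)"
      using x D fin by (auto intro!: sum.mono_neutral_left)
    then have "sum (\<lambda>c. u c x) D = 1" "(\<Sum>c\<in>D. u c x *\<^sub>R c) = x"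
      using bary(3)[of x] bary(4)[of x] by simp_all
    then show "x \<in> {y. \<exists>v. (\<forall>c\<in>D. 0 < v c) \<and> sum v D = 1 \<and> (\<Sum>c\<in>D. v c *\<^sub>R c) = y}"
      using x by (auto intro!: exI[of _ "\<lambda>c. u c x"])
  qed
qed

section \<open>The cells of a conforming mesh\<close>

lemma mesh_element_vertices:
  fixes \<T> :: "(real ^ 'd) set set"
  assumes "conforming_mesh \<T> \<Omega>" "\<tau> \<in> \<T>"
  obtains C where "\<not> affine_dependent C" "card C = Suc CARD('d)" "closure \<tau> = convex hull C"
proof -
  obtain C where C: "\<not> affine_dependent C" "card C = Suc CARD('d)" "\<tau> = interior (convex hull C)"
    using assms unfolding conforming_mesh_def open_simplex_def simplex_def by force
  then have "interior (convex hull C) \<noteq> {}"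
    using interior_convex_hull_eq_empty[of C] by simp
  then have "closure \<tau> = closure (convex hull C)"
    using C(3) by (simp add: convex_closure_interior)
  also have "\<dots> = convex hull C"
    using aff_independent_finite[OF C(1)] by (simp add: finite_imp_compact_convex_hull compact_imp_closed)
  finally show thesis using that C by blast
qed

lemma facet_hyperplane_equation:
  fixes \<T> :: "(real ^ 'd) set set"
  assumes "conforming_mesh \<T> \<Omega>" "h \<in> facet_hyperplanes \<T>"
  shows "\<exists>a b. h = {x. a \<bullet> x + b = 0}"
proof -
  obtain F \<tau> where h: "h = affine hull F" "\<tau> \<in> \<T>" "F facet_of closure \<tau>"
    using assms(2) by (auto simp: facet_hyperplanes_def)
  obtain C where C: "\<not> affine_dependent C" "card C = Suc CARD('d)" "closure \<tau> = convex hull C"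
    using mesh_element_vertices[OF assms(1) h(2)] .
  have "aff_dim F = DIM(real ^ 'd) - 1"
    using h(3) C aff_dim_affine_independent[OF C(1)]
    by (simp add: facet_of_def aff_dim_convex_hull)
  then obtain a b where "affine hull F = {x. a \<bullet> x = b}"
    unfolding aff_dim_eq_hyperplane by blast
  then have "h = {x. a \<bullet> x + (- b) = 0}" using h(1) by simp
  then show ?thesis by blast
qed

lemma vertex_facet_hyperplane:
  fixes C :: "(real ^ 'd) set"
  assumes "\<tau> \<in> \<T>" "closure \<tau> = convex hull C" "\<not> affine_dependent C" "card C = Suc CARD('d)" "c \<in> C"
  shows "affine hull (C - {c}) \<in> facet_hyperplanes \<T>"
proof -
  have "convex hull (C - {c}) facet_of closure \<tau>"
    unfolding assms(2) facet_of_convex_hull_affine_independent_alt[OF assms(3)]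
    using assms(4,5) by (auto simp: Suc_le_eq)
  then show ?thesis
    using assms(1) affine_hull_convex_hull[of "C - {c}"] unfolding facet_hyperplanes_def by blast
qed

lemma finite_facet_hyperplanes:
  fixes \<T> :: "(real ^ 'd) set set"
  assumes "conforming_mesh \<T> \<Omega>"
  shows "finite (facet_hyperplanes \<T>)"
proof -
  have "facet_hyperplanes \<T> = (\<Union>\<tau>\<in>\<T>. (\<lambda>F. affine hull F) ` {F. F facet_of closure \<tau>})"
    by (auto simp: facet_hyperplanes_def)
  moreover have "finite {F. F facet_of closure \<tau>}" if \<tau>: "\<tau> \<in> \<T>" for \<tau>
  proof -
    obtain C where C: "\<not> affine_dependent C" "card C = Suc CARD('d)" "closure \<tau> = convex hull C"
      using mesh_element_vertices[OF assms \<tau>] .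
    then have "polytope (closure \<tau>)"
      using aff_independent_finite[OF C(1)] by (simp add: polytope_convex_hull)
    then show ?thesis by (rule finite_polytope_facets)
  qed
  ultimately show ?thesis
    using assms by (simp add: conforming_mesh_def)
qed

lemma subsimplex_vertices:
  fixes \<T> :: "(real ^ 'd) set set"
  assumes "conforming_mesh \<T> \<Omega>" "\<sigma> \<in> subsimplices \<T>"
  obtains \<tau> C D where "\<tau> \<in> \<T>" "closure \<tau> = convex hull C" "\<not> affine_dependent C"
    "card C = Suc CARD('d)" "D \<subseteq> C" "\<sigma> = rel_interior (convex hull D)"
proof -
  obtain F \<tau> where F: "\<sigma> = rel_interior F" "\<tau> \<in> \<T>" "F face_of closure \<tau>"
    using assms(2) by (auto simp: subsimplices_def)
  obtain C where C: "\<not> affine_dependent C" "card C = Suc CARD('d)" "closure \<tau> = convex hull C"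
    using mesh_element_vertices[OF assms(1) F(2)] .
  moreover obtain D where "D \<subseteq> C" "F = convex hull D"
    using F(3) unfolding C(3) face_of_convex_hull_affine_independent[OF C(1)] by blast
  ultimately show thesis using F(1,2) that by blast
qed

text \<open>In a closed element, the vertices with positive barycentric coordinate span the face whose relative
  interior contains the point.\<close>
lemma subsimplices_cover:
  fixes \<T> :: "(real ^ 'd) set set"
  assumes mesh: "conforming_mesh \<T> \<Omega>" and x: "x \<in> closure \<Omega>"
  shows "\<exists>\<sigma>\<in>subsimplices \<T>. x \<in> \<sigma>"
proof -
  have "x \<in> (\<Union>\<tau>\<in>\<T>. closure \<tau>)"
    using mesh x by (simp add: conforming_mesh_def)
  then obtain \<tau> where \<tau>: "\<tau> \<in> \<T>" "x \<in> closure \<tau>" by blast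
  obtain C where C: "\<not> affine_dependent C" "card C = Suc CARD('d)" "closure \<tau> = convex hull C"
    using mesh_element_vertices[OF mesh \<tau>(1)] .
  have fin: "finite C" using C(1) by (rule aff_independent_finite)
  obtain v where v: "\<And>c. c \<in> C \<Longrightarrow> 0 \<le> v c" "sum v C = 1" "(\<Sum>c\<in>C. v c *\<^sub>R c) = x"
    using \<tau>(2) unfolding C(3) convex_hull_finite[OF fin] by blast
  define D where "D = {c\<in>C. v c > 0}"
  have D: "D \<subseteq> C" "\<And>c. c \<in> C - D \<Longrightarrow> v c = 0"
    using v(1) by (force simp: D_def)+
  then have s: "sum v D = 1" "(\<Sum>c\<in>D. v c *\<^sub>R c) = x"
    using v fin sum.mono_neutral_left[of C D v] sum.mono_neutral_left[of C D "\<lambda>c. v c *\<^sub>R c"] by auto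
  then have "x \<in> rel_interior (convex hull D)"
    unfolding rel_interior_convex_hull_explicit[OF affine_independent_subset[OF C(1) D(1)]]
    by (auto simp: D_def)
  moreover have "convex hull D face_of closure \<tau>"
    unfolding C(3) face_of_convex_hull_affine_independent[OF C(1)] using D(1) by blast
  moreover have "convex hull D \<noteq> {}" using s by auto
  ultimately show ?thesis
    using \<tau>(1) unfolding subsimplices_def by blast
qed

text \<open>Here conformity enters: if cells of two elements meet, both faces lie in the intersection of the
  closed elements, which is a face of each. So they are two faces of one convex set whose relative
  interiors meet, and hence equal.\<close>
lemma subsimplices_disjoint:
  assumes mesh: "conforming_mesh \<T> \<Omega>"
    and "\<sigma> \<in> subsimplices \<T>" "\<sigma>' \<in> subsimplices \<T>" "x \<in> \<sigma>" "x \<in> \<sigma>'"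
  shows "\<sigma> = \<sigma>'"
proof -
  obtain F \<tau> where F: "\<sigma> = rel_interior F" "\<tau> \<in> \<T>" "F face_of closure \<tau>"
    using assms by (auto simp: subsimplices_def)
  obtain F' \<tau>' where F': "\<sigma>' = rel_interior F'" "\<tau>' \<in> \<T>" "F' face_of closure \<tau>'"
    using assms by (auto simp: subsimplices_def)
  let ?G = "closure \<tau> \<inter> closure \<tau>'"
  have x: "x \<in> rel_interior F" "x \<in> rel_interior F'" using assms F F' by auto
  then have xG: "x \<in> ?G"
    using rel_interior_subset F(3) F'(3) face_of_imp_subset by blast
  obtain C where "closure \<tau> = convex hull C" using mesh_element_vertices[OF mesh F(2)] .
  then have "closure \<tau> face_of closure \<tau>" by (simp add: face_of_refl)
  moreover have "?G face_of closure \<tau> \<and> ?G face_of closure \<tau>'" if "\<tau> \<noteq> \<tau>'"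
    using mesh F(2) F'(2) xG that unfolding conforming_mesh_def by blast
  ultimately have G: "?G face_of closure \<tau>" "?G face_of closure \<tau>'"
    by (cases "\<tau> = \<tau>'"; simp)+
  have "F \<subseteq> ?G" using subset_of_face_of[OF G(1) face_of_imp_subset[OF F(3)]] x xG by blast
  moreover have "F' \<subseteq> ?G" using subset_of_face_of[OF G(2) face_of_imp_subset[OF F'(3)]] x xG by blast
  ultimately have "F face_of ?G" "F' face_of ?G"
    using F(3) F'(3) by (auto intro: face_of_subset)
  then have "F = F'" using x by (intro face_of_eq) auto
  then show ?thesis using F F' by simp
qed

text \<open>Faces of a simplex correspond to subsets of its $d+1$ vertices.\<close>
lemma card_subsimplices:
  fixes \<T> :: "(real ^ 'd) set set"
  assumes mesh: "conforming_mesh \<T> \<Omega>"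
  shows "finite (subsimplices \<T>)"
    and "card (subsimplices \<T>) \<le> (2 ^ (CARD('d) + 1) - 1) * card \<T>"
proof -
  let ?f = "\<lambda>\<tau>. rel_interior ` {F. F face_of closure \<tau> \<and> F \<noteq> {}}"
  let ?n = "2 ^ (CARD('d) + 1) - 1 :: nat"
  have fin: "finite \<T>" using mesh by (simp add: conforming_mesh_def)
  have eq: "subsimplices \<T> = (\<Union>\<tau>\<in>\<T>. ?f \<tau>)"
    by (auto simp: subsimplices_def)
  have f: "finite (?f \<tau>) \<and> card (?f \<tau>) \<le> ?n" if \<tau>: "\<tau> \<in> \<T>" for \<tau>
  proof -
    obtain C where C: "\<not> affine_dependent C" "card C = Suc CARD('d)" "closure \<tau> = convex hull C"
      using mesh_element_vertices[OF mesh \<tau>] .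
    have finC: "finite C" using C(1) by (rule aff_independent_finite)
    have "?f \<tau> \<subseteq> (\<lambda>D. rel_interior (convex hull D)) ` (Pow C - {{}})"
      unfolding C(3) face_of_convex_hull_affine_independent[OF C(1)] by auto
    moreover have "card (Pow C - {{}}) = ?n"
      using finC C(2) by (simp add: card_Diff_singleton card_Pow)
    ultimately show ?thesis
      using finC surj_card_le[of "Pow C - {{}}"] finite_surj[of "Pow C - {{}}"] by auto
  qed
  then show "finite (subsimplices \<T>)" unfolding eq using fin by blast
  have "card (subsimplices \<T>) \<le> (\<Sum>\<tau>\<in>\<T>. card (?f \<tau>))"
    unfolding eq by (rule card_UN_le[OF fin])
  also have "\<dots> \<le> (\<Sum>\<tau>\<in>\<T>. ?n)" using f by (intro sum_mono) blast
  finally show "card (subsimplices \<T>) \<le> ?n * card \<T>" by (simp add: mult.commute)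
qed

section \<open>Functions computable as inputs of second-layer neurons\<close>

text \<open>The weights and the bias of a single second-layer neuron are free here while the first layer is
  fixed. Each neuron reads only its own row of the weight matrices, so the constant rows and the
  index 0 lose nothing.\<close>
definition second_layer_input ::
  "nat \<Rightarrow> (nat \<Rightarrow> real ^ 'd) \<Rightarrow> (nat \<Rightarrow> real) \<Rightarrow> (real ^ 'd \<Rightarrow> real) \<Rightarrow> bool" where
  "second_layer_input n W b f \<longleftrightarrow>
     (\<exists>w0 w1 c. \<forall>x. f x = second_preact n W b (\<lambda>_. w0) (\<lambda>_. w1) (\<lambda>_. c) x 0)"

lemma second_layer_input_const: "second_layer_input n W b (\<lambda>_. c)"
  unfolding second_layer_input_def second_preact_def
  by (intro exI[of _ "\<lambda>_. 0"] exI[of _ c]) simp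

lemma second_layer_input_add:
  assumes "second_layer_input n W b f" "second_layer_input n W b g"
  shows "second_layer_input n W b (\<lambda>x. f x + g x)"
proof -
  obtain w0 w1 c w0' w1' c' where
    "\<And>x. f x = second_preact n W b (\<lambda>_. w0) (\<lambda>_. w1) (\<lambda>_. c) x 0"
    "\<And>x. g x = second_preact n W b (\<lambda>_. w0') (\<lambda>_. w1') (\<lambda>_. c') x 0"
    using assms unfolding second_layer_input_def by blast
  then show ?thesis
    unfolding second_layer_input_def second_preact_def
    by (intro exI[of _ "\<lambda>l. w0 l + w0' l"] exI[of _ "\<lambda>l. w1 l + w1' l"] exI[of _ "c + c'"])
       (simp add: sum.distrib distrib_right)
qed

lemma second_layer_input_scale:
  assumes "second_layer_input n W b f"
  shows "second_layer_input n W b (\<lambda>x. r * f x)"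
proof -
  obtain w0 w1 c where "\<And>x. f x = second_preact n W b (\<lambda>_. w0) (\<lambda>_. w1) (\<lambda>_. c) x 0"
    using assms unfolding second_layer_input_def by blast
  then show ?thesis
    unfolding second_layer_input_def second_preact_def
    by (intro exI[of _ "\<lambda>l. r * w0 l"] exI[of _ "\<lambda>l. r * w1 l"] exI[of _ "r * c"])
       (simp add: sum_distrib_left distrib_left mult.assoc)
qed

lemma second_layer_input_sum:
  assumes "\<And>i. i \<in> I \<Longrightarrow> second_layer_input n W b (f i)"
  shows "second_layer_input n W b (\<lambda>x. \<Sum>i\<in>I. f i x)"
  using assms
  by (induction I rule: infinite_finite_induct)
     (simp_all add: second_layer_input_const second_layer_input_add)

lemma second_layer_input_activations:
  assumes "l < n"
  shows "second_layer_input n W b (\<lambda>x. rho 0 (W l \<bullet> x + b l))"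
    and "second_layer_input n W b (\<lambda>x. rho 1 (W l \<bullet> x + b l))"
proof -
  have delta: "(\<Sum>i<n. (if i = l then 1 else 0) * f i) = f l" for f :: "nat \<Rightarrow> real"
    using assms by (simp add: if_distrib[where f = "\<lambda>t. t * _"] cong: if_cong)
  show "second_layer_input n W b (\<lambda>x. rho 0 (W l \<bullet> x + b l))"
    unfolding second_layer_input_def second_preact_def first_preact_def
    by (intro exI[of _ "\<lambda>i. if i = l then 1 else 0"] exI[of _ "\<lambda>_. 0"] exI[of _ 0])
       (simp only: delta, simp)
  show "second_layer_input n W b (\<lambda>x. rho 1 (W l \<bullet> x + b l))"
    unfolding second_layer_input_def second_preact_def first_preact_def
    by (intro exI[of _ "\<lambda>_. 0"] exI[of _ "\<lambda>i. if i = l then 1 else 0"] exI[of _ 0])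
       (simp only: delta, simp)
qed

text \<open>Both orientations of every hyperplane are needed. The Heaviside units then test $> 0$ and $< 0$
  separately, so that equality can be tested by excluding both, and the identity
  $t = \varrho_1(t) - \varrho_1(-t)$ recovers the affine form itself.\<close>
lemma hyperplane_first_layer:
  fixes a :: "(real ^ 'd) set \<Rightarrow> real ^ 'd" and b :: "(real ^ 'd) set \<Rightarrow> real"
  assumes "finite \<H>"
  obtains W c where
    "\<And>h. h \<in> \<H> \<Longrightarrow> second_layer_input (2 * card \<H>) W c (\<lambda>x. a h \<bullet> x + b h)"
    "\<And>h. h \<in> \<H> \<Longrightarrow> second_layer_input (2 * card \<H>) W c (\<lambda>x. rho 0 (a h \<bullet> x + b h))"
    "\<And>h. h \<in> \<H> \<Longrightarrow> second_layer_input (2 * card \<H>) W c (\<lambda>x. rho 0 (- (a h \<bullet> x + b h)))"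
proof -
  let ?n = "card \<H>"
  obtain e where e: "bij_betw e {0..<?n} \<H>"
    using ex_bij_betw_nat_finite[OF assms] by blast
  define W where "W = (\<lambda>l. if l < ?n then a (e l) else - a (e (l - ?n)))"
  define c where "c = (\<lambda>l. if l < ?n then b (e l) else - b (e (l - ?n)))"
  have *: "second_layer_input (2 * ?n) W c (\<lambda>x. rho 0 (a h \<bullet> x + b h))"
       "second_layer_input (2 * ?n) W c (\<lambda>x. rho 1 (a h \<bullet> x + b h))"
       "second_layer_input (2 * ?n) W c (\<lambda>x. rho 0 (- (a h \<bullet> x + b h)))"
       "second_layer_input (2 * ?n) W c (\<lambda>x. rho 1 (- (a h \<bullet> x + b h)))" if h: "h \<in> \<H>" for h
  proof -
    have "h \<in> e ` {0..<?n}" using e h by (simp add: bij_betw_imp_surj_on)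
    then obtain l where l: "l < ?n" "e l = h" by auto
    then have "l < 2 * ?n" "l + ?n < 2 * ?n" by auto
    note act = this[THEN second_layer_input_activations(1), of W c]
      this[THEN second_layer_input_activations(2), of W c]
    have pos: "W l \<bullet> x + c l = a h \<bullet> x + b h" for x
      using l by (simp add: W_def c_def)
    have neg: "W (l + ?n) \<bullet> x + c (l + ?n) = - (a h \<bullet> x + b h)" for x
      using l by (simp add: W_def c_def)
    show "second_layer_input (2 * ?n) W c (\<lambda>x. rho 0 (a h \<bullet> x + b h))"
       "second_layer_input (2 * ?n) W c (\<lambda>x. rho 1 (a h \<bullet> x + b h))"
       "second_layer_input (2 * ?n) W c (\<lambda>x. rho 0 (- (a h \<bullet> x + b h)))"
       "second_layer_input (2 * ?n) W c (\<lambda>x. rho 1 (- (a h \<bullet> x + b h)))"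
      using act unfolding pos neg by blast+
  qed
  have "second_layer_input (2 * ?n) W c (\<lambda>x. a h \<bullet> x + b h)" if h: "h \<in> \<H>" for h
  proof -
    have "t = rho 1 t + (- 1) * rho 1 (- t)" for t :: real by (simp add: rho_def)
    then have "(\<lambda>x. a h \<bullet> x + b h) =
        (\<lambda>x. rho 1 (a h \<bullet> x + b h) + (- 1) * rho 1 (- (a h \<bullet> x + b h)))" by (rule ext)
    then show ?thesis
      using second_layer_input_add[OF *(2)[OF h] second_layer_input_scale[OF *(4)[OF h], of "- 1"]]
      by simp
  qed
  from that[OF this *(1) *(3)] show thesis by assumption
qed

text \<open>The facet forms of one element already generate all affine functions, because an affine function is
  the combination of the barycentric coordinates with its vertex values as coefficients. The
  function \<open>V\<close> counts the sign conditions of the cell that a point violates, so subtracting a large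
  multiple of it switches a neuron off outside the cell and leaves it unchanged on the cell.\<close>
lemma cell_neurons:
  fixes \<T> :: "(real ^ 'd) set set" and a :: "(real ^ 'd) set \<Rightarrow> real ^ 'd"
  assumes mesh: "conforming_mesh \<T> \<Omega>" and \<sigma>: "\<sigma> \<in> subsimplices \<T>"
    and eq: "\<And>h. h \<in> facet_hyperplanes \<T> \<Longrightarrow> h = {x. a h \<bullet> x + b h = 0}"
    and lin: "\<And>h. h \<in> facet_hyperplanes \<T> \<Longrightarrow> second_layer_input n W c (\<lambda>x. a h \<bullet> x + b h)"
    and pos: "\<And>h. h \<in> facet_hyperplanes \<T> \<Longrightarrow> second_layer_input n W c (\<lambda>x. rho 0 (a h \<bullet> x + b h))"
    and neg: "\<And>h. h \<in> facet_hyperplanes \<T> \<Longrightarrow> second_layer_input n W c (\<lambda>x. rho 0 (- (a h \<bullet> x + b h)))"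
  shows affine_second_layer_input: "second_layer_input n W c (\<lambda>x. p \<bullet> x + q)"
    and violation_second_layer_input:
      "\<exists>V. second_layer_input n W c V \<and> (\<forall>x\<in>\<sigma>. V x = 0) \<and> (\<forall>x. x \<notin> \<sigma> \<longrightarrow> V x \<ge> 1)"
proof -
  obtain \<tau> C D where \<tau>: "\<tau> \<in> \<T>" "closure \<tau> = convex hull C" and C: "\<not> affine_dependent C"
    "card C = Suc CARD('d)" and D: "D \<subseteq> C" "\<sigma> = rel_interior (convex hull D)"
    using subsimplex_vertices[OF mesh \<sigma>] .
  have fin: "finite C" using C(1) by (rule aff_independent_finite)
  define h where "h = (\<lambda>c. affine hull (C - {c}))"
  have h: "h v \<in> facet_hyperplanes \<T>" if "v \<in> C" for v
    using vertex_facet_hyperplane[OF \<tau> C that] by (simp add: h_def)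
  have C': "card C = Suc (DIM(real ^ 'd))" using C(2) by simp
  have facet: "affine hull (C - {v}) = {x. a (h v) \<bullet> x + b (h v) = 0}" if "v \<in> C" for v
    using eq[OF h[OF that]] by (simp add: h_def)
  define g where "g = (\<lambda>v x. a (h v) \<bullet> x + b (h v))"
  define u where "u = barycentric (\<lambda>v. a (h v)) (\<lambda>v. b (h v))"
  have u: "u v x = g v x / g v v" for v x by (simp add: u_def barycentric_def g_def)
  note bary = barycentric_coordinates[OF C(1) C' facet, folded u_def]
  have cell: "\<sigma> = {x. (\<forall>v\<in>D. u v x > 0) \<and> (\<forall>v\<in>C - D. u v x = 0)}"
    unfolding u_def D(2) by (rule rel_interior_face_barycentric[OF C(1) C' facet D(1)])
  have u_in: "second_layer_input n W c (u v)" if "v \<in> C" for v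
    using second_layer_input_scale[OF lin[OF h[OF that]], of "inverse (g v v)"]
    by (simp add: u[abs_def] g_def divide_inverse mult.commute)
  have p_q: "p \<bullet> x + q = (\<Sum>v\<in>C. (p \<bullet> v + q) * u v x)" for x
  proof -
    have "p \<bullet> x + q = p \<bullet> (\<Sum>v\<in>C. u v x *\<^sub>R v) + q * (\<Sum>v\<in>C. u v x)"
      using bary(3)[of x] bary(4)[of x] by simp
    then show ?thesis
      by (simp add: inner_sum_right sum_distrib_left distrib_left sum.distrib mult_ac)
  qed
  have "second_layer_input n W c (\<lambda>x. \<Sum>v\<in>C. (p \<bullet> v + q) * u v x)"
    by (intro second_layer_input_sum second_layer_input_scale u_in)
  then show "second_layer_input n W c (\<lambda>x. p \<bullet> x + q)"
    by (simp only: p_q[symmetric])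
  have step_u: "second_layer_input n W c (\<lambda>x. rho 0 (u v x)) \<and>
      second_layer_input n W c (\<lambda>x. rho 0 (- u v x))" if v: "v \<in> C" for v
  proof (cases "g v v > 0")
    case True
    then have "rho 0 (u v x) = rho 0 (g v x)" "rho 0 (- u v x) = rho 0 (- g v x)" for x
      by (simp_all add: rho_def u zero_less_divide_iff divide_less_0_iff)
    then show ?thesis using pos[OF h[OF v]] neg[OF h[OF v]] by (simp add: g_def)
  next
    case False
    then have "g v v < 0" using bary(1)[OF _ v] by (simp add: g_def)
    then have "rho 0 (u v x) = rho 0 (- g v x)" "rho 0 (- u v x) = rho 0 (g v x)" for x
      by (auto simp add: rho_def u zero_less_divide_iff divide_less_0_iff)
    then show ?thesis using pos[OF h[OF v]] neg[OF h[OF v]] by (simp add: g_def)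
  qed
  define viol where "viol = (\<lambda>v x. if v \<in> D then 1 + (- 1) * rho 0 (u v x)
    else rho 0 (u v x) + rho 0 (- u v x))"
  have viol: "viol v x = (if (if v \<in> D then u v x > 0 else u v x = 0) then 0 else 1)" for v x
    by (auto simp: viol_def rho_def)
  define V where "V = (\<lambda>x. \<Sum>v\<in>C. viol v x)"
  have "second_layer_input n W c (viol v)" if v: "v \<in> C" for v
  proof (cases "v \<in> D")
    case True
    have "second_layer_input n W c (\<lambda>x. 1 + (- 1) * rho 0 (u v x))"
      using step_u[OF v]
      by (intro second_layer_input_add second_layer_input_scale second_layer_input_const) simp
    then show ?thesis using True by (simp add: viol_def)
  next
    case False
    have "second_layer_input n W c (\<lambda>x. rho 0 (u v x) + rho 0 (- u v x))"
      using step_u[OF v] by (intro second_layer_input_add) simp_all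
    then show ?thesis using False by (simp add: viol_def)
  qed
  then have "second_layer_input n W c V"
    unfolding V_def by (rule second_layer_input_sum)
  moreover have "V x = 0" if "x \<in> \<sigma>" for x
    using that D(1) unfolding V_def cell by (intro sum.neutral) (auto simp: viol)
  moreover have "V x \<ge> 1" if x: "x \<notin> \<sigma>" for x
  proof -
    have "\<exists>v\<in>C. viol v x = 1"
      using x D(1) unfolding cell by (auto simp: viol)
    then obtain v where v: "v \<in> C" "viol v x = 1" ..
    have "viol v x \<le> V x"
      unfolding V_def by (rule member_le_sum) (use v fin in \<open>auto simp: viol\<close>)
    then show ?thesis using v by simp
  qed
  ultimately show "\<exists>V. second_layer_input n W c V \<and> (\<forall>x\<in>\<sigma>. V x = 0) \<and> (\<forall>x. x \<notin> \<sigma> \<longrightarrow> V x \<ge> 1)"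
    by blast
qed

lemma span_basis_coordinates:
  assumes "is_basis m b E" "y \<in> E"
  shows "\<exists>r. y = (\<Sum>i<m. r i *\<^sub>R b i)"
proof -
  have "y \<in> span (b ` {..<m})" using assms by (simp add: is_basis_def)
  then obtain s where "y = (\<Sum>e\<in>b ` {..<m}. s e *\<^sub>R e)"
    by (auto simp: span_finite)
  then have "y = (\<Sum>i<m. s (b i) *\<^sub>R b i)"
    using assms(1) by (simp add: is_basis_def sum.reindex)
  then show ?thesis by (rule exI[of _ "\<lambda>i. s (b i)"])
qed

section \<open>Assembling the network\<close>

text \<open>There is one second-layer neuron for each pair of a cell $\sigma$ and a multi-index $\beta$. On
  \<open>closure \<Omega>\<close> its output is $L_\beta(x)^k$ for $x \in \sigma$ and $0$ otherwise. These outputs are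
  fixed in advance, and the output coefficients of a function are the coefficients of its
  polynomial pieces with respect to the powers $L_\beta^k$.\<close>
lemma universal_hidden_parameters:
  fixes \<T> :: "(real ^ 'd) set set" and k :: nat
  assumes mesh: "conforming_mesh \<T> \<Omega>" and bdd: "bounded \<Omega>"
  defines "N \<equiv> ((CARD('d) + k) choose CARD('d)) * card (subsimplices \<T>)"
    and "H \<equiv> card (facet_hyperplanes \<T>)"
  shows "\<exists>W b W0 W1 b2. \<forall>m (E :: 'e::real_vector set) e. is_basis m e E \<longrightarrow>
    (\<forall>v\<in>DG_space k \<T> E. \<exists>W3. \<forall>x\<in>closure \<Omega>.
       v x = of_coords m e (network m k (2 * H) N W b W0 W1 b2 W3 x))"
proof -
  let ?A = "multi_indices k :: ('d \<Rightarrow> nat) set"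
  let ?S = "subsimplices \<T>"
  note finA = card_multi_indices(1)[of k, where 'd = 'd]
  note finS = card_subsimplices(1)[OF mesh]

  obtain B where B: "\<And>x. x \<in> closure \<Omega> \<Longrightarrow> norm x \<le> B" "B > 0"
    using bounded_closure[OF bdd] by (auto simp: bounded_pos)
  \<comment> \<open>With this scaling $|\varepsilon\,\beta\cdot x| \le 1/2$ on \<open>closure \<Omega>\<close>, which keeps every $L_\beta$ positive there, so that
    $\varrho_k$ acts on it as the plain $k$-th power.\<close>
  define \<epsilon> where "\<epsilon> = 1 / (2 * (real k * B + 1))"
  have kB: "0 \<le> real k * B" using B(2) by simp
  then have \<epsilon>: "\<epsilon> > 0" "\<epsilon> * (real k * B) \<le> 1 / 2"
    by (simp_all add: \<epsilon>_def divide_le_eq)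
  define L where "L = (\<lambda>\<beta> (x :: real ^ 'd). 1 + (\<Sum>i\<in>UNIV. real (\<beta> i) * (\<epsilon> * x $ i)))"
  have L: "0 < L \<beta> x" "L \<beta> x \<le> 2" if \<beta>: "\<beta> \<in> ?A" and x: "x \<in> closure \<Omega>" for \<beta> x
  proof -
    have "\<bar>\<Sum>i\<in>UNIV. real (\<beta> i) * (\<epsilon> * x $ i)\<bar> \<le> (\<Sum>i\<in>UNIV. \<bar>real (\<beta> i) * (\<epsilon> * x $ i)\<bar>)"
      by (rule sum_abs)
    also have "\<dots> \<le> (\<Sum>i\<in>UNIV. real (\<beta> i) * (\<epsilon> * B))"
    proof (rule sum_mono)
      fix i
      have "\<bar>x $ i\<bar> \<le> B" using component_le_norm_cart[of x i] B(1)[OF x] by simp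
      then show "\<bar>real (\<beta> i) * (\<epsilon> * x $ i)\<bar> \<le> real (\<beta> i) * (\<epsilon> * B)"
        using \<epsilon>(1) by (simp add: abs_mult mult_left_mono)
    qed
    also have "\<dots> = real (\<Sum>i\<in>UNIV. \<beta> i) * (\<epsilon> * B)"
      by (simp add: sum_distrib_right)
    also have "\<dots> \<le> real k * (\<epsilon> * B)"
      using \<beta> \<epsilon>(1) B(2) by (intro mult_right_mono) (simp_all add: multi_indices_def flip: of_nat_sum)
    also have "\<dots> \<le> 1 / 2" using \<epsilon>(2) by (simp add: mult_ac)
    finally show "0 < L \<beta> x" "L \<beta> x \<le> 2" by (simp_all add: L_def abs_le_iff)
  qed

  obtain a b where ab: "\<And>h. h \<in> facet_hyperplanes \<T> \<Longrightarrow> h = {x. a h \<bullet> x + b h = 0}"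
    using facet_hyperplane_equation[OF mesh] by metis
  obtain W c where layer:
    "\<And>h. h \<in> facet_hyperplanes \<T> \<Longrightarrow> second_layer_input (2 * H) W c (\<lambda>x. a h \<bullet> x + b h)"
    "\<And>h. h \<in> facet_hyperplanes \<T> \<Longrightarrow> second_layer_input (2 * H) W c (\<lambda>x. rho 0 (a h \<bullet> x + b h))"
    "\<And>h. h \<in> facet_hyperplanes \<T> \<Longrightarrow> second_layer_input (2 * H) W c (\<lambda>x. rho 0 (- (a h \<bullet> x + b h)))"
    by (rule hyperplane_first_layer[OF finite_facet_hyperplanes[OF mesh], of a b, folded H_def])
       (rule that; blast)
  note cell = cell_neurons[OF mesh _ ab layer]

  have neuron: "\<exists>g. second_layer_input (2 * H) W c g \<and>
      (\<forall>x\<in>closure \<Omega>. rho k (g x) = (if x \<in> \<sigma> then L \<beta> x ^ k else 0))"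
    if \<sigma>: "\<sigma> \<in> ?S" and \<beta>: "\<beta> \<in> ?A" for \<sigma> \<beta>
  proof -
    obtain V where V: "second_layer_input (2 * H) W c V"
      "\<And>x. x \<in> \<sigma> \<Longrightarrow> V x = 0" "\<And>x. x \<notin> \<sigma> \<Longrightarrow> V x \<ge> 1"
      using cell(2)[OF \<sigma>] by blast
    define p :: "real ^ 'd" where "p = (\<chi> i. \<epsilon> * real (\<beta> i))"
    have "L \<beta> = (\<lambda>x. p \<bullet> x + 1)"
      by (simp add: fun_eq_iff L_def p_def inner_vec_def mult_ac)
    then have "second_layer_input (2 * H) W c (L \<beta>)"
      using cell(1)[OF \<sigma>, of p 1] by simp
    \<comment> \<open>Since $L_\beta \le 2$ on \<open>closure \<Omega>\<close>, one violated condition already makes the input nonpositive.\<close>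
    then have "second_layer_input (2 * H) W c (\<lambda>x. L \<beta> x + (- 2) * V x)"
      using V(1) by (intro second_layer_input_add second_layer_input_scale)
    moreover have "rho k (L \<beta> x + (- 2) * V x) = (if x \<in> \<sigma> then L \<beta> x ^ k else 0)"
      if x: "x \<in> closure \<Omega>" for x
      using V(2,3)[of x] L[OF \<beta> x] by (cases "x \<in> \<sigma>") (auto simp: rho_def)
    ultimately show ?thesis by blast
  qed
  have "\<forall>s\<in>?S \<times> ?A. \<exists>g. second_layer_input (2 * H) W c g \<and>
      (\<forall>x\<in>closure \<Omega>. rho k (g x) = (if x \<in> fst s then L (snd s) x ^ k else 0))"
    by (rule ballI, rule neuron) (simp_all add: mem_Times_iff)
  from bchoice[OF this] obtain g where g_all: "\<forall>s\<in>?S \<times> ?A. second_layer_input (2 * H) W c (g s) \<and>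
      (\<forall>x\<in>closure \<Omega>. rho k (g s x) = (if x \<in> fst s then L (snd s) x ^ k else 0))" ..
  have g: "\<And>s. s \<in> ?S \<times> ?A \<Longrightarrow> second_layer_input (2 * H) W c (g s)"
    "\<And>s x. \<lbrakk>s \<in> ?S \<times> ?A; x \<in> closure \<Omega>\<rbrakk> \<Longrightarrow>
        rho k (g s x) = (if x \<in> fst s then L (snd s) x ^ k else 0)"
    using bspec[OF g_all] by simp_all

  have "card (?S \<times> ?A) = N"
    by (simp add: N_def card_cartesian_product card_multi_indices(2) mult.commute)
  then obtain \<phi> where \<phi>: "bij_betw \<phi> {..<N} (?S \<times> ?A)"
    using ex_bij_betw_nat_finite[of "?S \<times> ?A"] finS finA by (auto simp: atLeast0LessThan)
  have "\<forall>j\<in>{..<N}. \<exists>p. \<forall>x. g (\<phi> j) x =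
      second_preact (2 * H) W c (\<lambda>_. fst p) (\<lambda>_. fst (snd p)) (\<lambda>_. snd (snd p)) x 0"
  proof
    fix j assume "j \<in> {..<N}"
    then have "\<phi> j \<in> ?S \<times> ?A" using \<phi> by (rule bij_betw_apply[rotated])
    then show "\<exists>p. \<forall>x. g (\<phi> j) x =
        second_preact (2 * H) W c (\<lambda>_. fst p) (\<lambda>_. fst (snd p)) (\<lambda>_. snd (snd p)) x 0"
      using g(1)[of "\<phi> j"] by (auto simp: second_layer_input_def)
  qed
  from bchoice[OF this] obtain p where p: "\<forall>j\<in>{..<N}. \<forall>x. g (\<phi> j) x =
      second_preact (2 * H) W c (\<lambda>_. fst (p j)) (\<lambda>_. fst (snd (p j))) (\<lambda>_. snd (snd (p j))) x 0" ..
  define W0 W1 b2 where "W0 = (\<lambda>j. fst (p j))" and "W1 = (\<lambda>j. fst (snd (p j)))"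
    and "b2 = (\<lambda>j. snd (snd (p j)))"
  have hidden: "g (\<phi> j) x = second_preact (2 * H) W c W0 W1 b2 x j" if "j < N" for j x
    using p that by (simp add: second_preact_def W0_def W1_def b2_def)

  have "\<exists>W3. \<forall>x\<in>closure \<Omega>. v x = of_coords m e (network m k (2 * H) N W c W0 W1 b2 W3 x)"
    if basis: "is_basis m e E" and v: "v \<in> DG_space k \<T> E" for m e and E :: "'e set" and v
  proof -
    have "\<forall>\<sigma>\<in>?S. \<exists>r. \<forall>x\<in>\<sigma>.
        v x = (\<Sum>\<alpha>\<in>?A. (\<Prod>i\<in>UNIV. x $ i ^ \<alpha> i) *\<^sub>R (\<Sum>i<m. r \<alpha> i *\<^sub>R e i))"
    proof
      fix \<sigma> assume "\<sigma> \<in> ?S"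
      obtain C where C: "\<And>\<alpha>. C \<alpha> \<in> E" "\<And>x. x \<in> \<sigma> \<Longrightarrow> v x = (\<Sum>\<alpha>\<in>?A. (\<Prod>i\<in>UNIV. x $ i ^ \<alpha> i) *\<^sub>R C \<alpha>)"
        using v \<open>\<sigma> \<in> ?S\<close> unfolding DG_space_def polys_def multi_indices_def by blast
      have "\<forall>\<alpha>. \<exists>r. C \<alpha> = (\<Sum>i<m. r i *\<^sub>R e i)"
        using span_basis_coordinates[OF basis C(1)] by blast
      from choice[OF this] obtain r where "\<And>\<alpha>. C \<alpha> = (\<Sum>i<m. r \<alpha> i *\<^sub>R e i)" by blast
      then show "\<exists>r. \<forall>x\<in>\<sigma>.
          v x = (\<Sum>\<alpha>\<in>?A. (\<Prod>i\<in>UNIV. x $ i ^ \<alpha> i) *\<^sub>R (\<Sum>i<m. r \<alpha> i *\<^sub>R e i))"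
        using C(2) by auto
    qed
    from bchoice[OF this] obtain r where r: "\<forall>\<sigma>\<in>?S. \<forall>x\<in>\<sigma>.
        v x = (\<Sum>\<alpha>\<in>?A. (\<Prod>i\<in>UNIV. x $ i ^ \<alpha> i) *\<^sub>R (\<Sum>i<m. r \<sigma> \<alpha> i *\<^sub>R e i))" ..
    have "\<forall>\<alpha>\<in>?A. \<exists>w. \<forall>z. (\<Prod>i\<in>UNIV. z i ^ \<alpha> i) =
        (\<Sum>\<beta>\<in>?A. w \<beta> * (1 + (\<Sum>i\<in>UNIV. real (\<beta> i) * z i)) ^ k)"
      by (rule ballI) (rule monomial_in_span_powers)
    from bchoice[OF this] obtain w where w: "\<forall>\<alpha>\<in>?A. \<forall>z. (\<Prod>i\<in>UNIV. z i ^ \<alpha> i) =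
        (\<Sum>\<beta>\<in>?A. w \<alpha> \<beta> * (1 + (\<Sum>i\<in>UNIV. real (\<beta> i) * z i)) ^ k)" ..
    \<comment> \<open>Substituting $z = \varepsilon x$ multiplies the monomial $x^\alpha$ by $\varepsilon^{|\alpha|}$.\<close>
    define w' where "w' = (\<lambda>\<alpha> \<beta>. w \<alpha> \<beta> / \<epsilon> ^ (\<Sum>i\<in>UNIV. \<alpha> i))"
    have w': "(\<Prod>i\<in>UNIV. x $ i ^ \<alpha> i) = (\<Sum>\<beta>\<in>?A. w' \<alpha> \<beta> * L \<beta> x ^ k)"
      if "\<alpha> \<in> ?A" for \<alpha> x
    proof -
      have "(\<Prod>i\<in>UNIV. (\<epsilon> * x $ i) ^ \<alpha> i) = \<epsilon> ^ (\<Sum>i\<in>UNIV. \<alpha> i) * (\<Prod>i\<in>UNIV. x $ i ^ \<alpha> i)"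
        by (simp add: power_mult_distrib prod.distrib power_sum)
      then show ?thesis
        using spec[OF bspec[OF w that], of "\<lambda>i. \<epsilon> * x $ i"] \<epsilon>(1)
        by (simp add: w'_def L_def field_simps flip: sum_divide_distrib)
    qed
    define out where "out = (\<lambda>i (\<sigma>, \<beta>). \<Sum>\<alpha>\<in>?A. r \<sigma> \<alpha> i * w' \<alpha> \<beta>)"
    have "v x = of_coords m e (network m k (2 * H) N W c W0 W1 b2 (\<lambda>i j. out i (\<phi> j)) x)"
      if x: "x \<in> closure \<Omega>" for x
    proof -
      obtain \<sigma> where \<sigma>: "\<sigma> \<in> ?S" "x \<in> \<sigma>" using subsimplices_cover[OF mesh x] by blast
      have net: "network m k (2 * H) N W c W0 W1 b2 (\<lambda>i j. out i (\<phi> j)) x i =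
          (\<Sum>\<alpha>\<in>?A. r \<sigma> \<alpha> i * (\<Prod>i\<in>UNIV. x $ i ^ \<alpha> i))" if "i < m" for i
      proof -
        have "network m k (2 * H) N W c W0 W1 b2 (\<lambda>i j. out i (\<phi> j)) x i =
            (\<Sum>j<N. out i (\<phi> j) * rho k (g (\<phi> j) x))"
          using that by (simp add: network_def hidden)
        also have "\<dots> = (\<Sum>s\<in>?S \<times> ?A. out i s * rho k (g s x))"
          using \<phi> by (rule sum.reindex_bij_betw)
        also have "\<dots> = (\<Sum>\<sigma>'\<in>?S. \<Sum>\<beta>\<in>?A. out i (\<sigma>', \<beta>) * (if x \<in> \<sigma>' then L \<beta> x ^ k else 0))"
          using x by (subst sum.cartesian_product) (auto simp: g(2) intro!: sum.cong)
        also have "\<dots> = (\<Sum>\<sigma>'\<in>{\<sigma>}. \<Sum>\<beta>\<in>?A. out i (\<sigma>', \<beta>) * (if x \<in> \<sigma>' then L \<beta> x ^ k else 0))"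
        proof (intro sum.mono_neutral_right ballI)
          fix \<sigma>' assume "\<sigma>' \<in> ?S - {\<sigma>}"
          then have "x \<notin> \<sigma>'" using subsimplices_disjoint[OF mesh] \<sigma> by blast
          then show "(\<Sum>\<beta>\<in>?A. out i (\<sigma>', \<beta>) * (if x \<in> \<sigma>' then L \<beta> x ^ k else 0)) = 0" by simp
        qed (use finS \<sigma> in auto)
        also have "\<dots> = (\<Sum>\<beta>\<in>?A. \<Sum>\<alpha>\<in>?A. r \<sigma> \<alpha> i * (w' \<alpha> \<beta> * L \<beta> x ^ k))"
          using \<sigma> by (simp add: out_def sum_distrib_right mult.assoc)
        also have "\<dots> = (\<Sum>\<alpha>\<in>?A. r \<sigma> \<alpha> i * (\<Prod>i\<in>UNIV. x $ i ^ \<alpha> i))"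
          by (subst sum.swap) (simp add: w' sum_distrib_left)
        finally show ?thesis .
      qed
      have "v x = (\<Sum>\<alpha>\<in>?A. \<Sum>i<m. (r \<sigma> \<alpha> i * (\<Prod>i\<in>UNIV. x $ i ^ \<alpha> i)) *\<^sub>R e i)"
        using bspec[OF bspec[OF r \<sigma>(1)] \<sigma>(2)] by (simp add: scaleR_sum_right mult.commute)
      also have "\<dots> = (\<Sum>i<m. (\<Sum>\<alpha>\<in>?A. r \<sigma> \<alpha> i * (\<Prod>i\<in>UNIV. x $ i ^ \<alpha> i)) *\<^sub>R e i)"
        by (subst sum.swap) (simp add: scaleR_sum_left)
      finally show ?thesis by (simp add: of_coords_def net)
    qed
    then show ?thesis by blast
  qed
  then show ?thesis by blast
qed

theorem theorem8:
  fixes \<Omega> :: "(real ^ 'd) set" and \<T> :: "(real ^ 'd) set set" and k d M H N_T N_S :: nat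
  assumes "bounded_open_polyhedral \<Omega>"
    and "conforming_mesh \<T> \<Omega>"
  defines "d \<equiv> CARD('d)"
    and "M \<equiv> (d + k) choose d"
    and "H \<equiv> card (facet_hyperplanes \<T>)"
    and "N_T \<equiv> card \<T>"
    and "N_S \<equiv> card (subsimplices \<T>)"
  shows
    "(\<forall>m (E :: 'e::real_vector set) b. 1 \<le> m \<longrightarrow> is_basis m b E \<longrightarrow>
        (\<forall>v\<in>DG_space k \<T> E. \<exists>f\<in>NN m k (2 * H) (M * N_S).
           \<forall>x\<in>closure \<Omega>. v x = of_coords m b (f x)))
     \<and> (\<forall>\<iota>. incident_choice \<T> \<iota> \<longrightarrow>
          (\<exists>W\<^sub>I b\<^sub>I W\<^sub>0 W\<^sub>1 b\<^sub>I\<^sub>I.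
             \<forall>m (E :: 'e set) b. 1 \<le> m \<longrightarrow> is_basis m b E \<longrightarrow>
               (\<forall>v\<in>DG_space k \<T> E. \<exists>W\<^sub>I\<^sub>I\<^sub>I. \<forall>x\<in>closure \<Omega>.
                  v x = of_coords m b
                    (network m k (2 * H) (M * N_S) W\<^sub>I b\<^sub>I W\<^sub>0 W\<^sub>1 b\<^sub>I\<^sub>I W\<^sub>I\<^sub>I\<^sub>I x))))
     \<and> M * N_S \<le> M * (2 ^ (d + 1) - 1) * N_T"
proof -
  have "bounded \<Omega>" using assms(1) by (simp add: bounded_open_polyhedral_def)
  from universal_hidden_parameters[OF assms(2) this, of k, where 'e = 'e, folded d_def,
      folded M_def H_def N_S_def]
  obtain W b W0 W1 b2 where hidden: "\<forall>m (E :: 'e set) e. is_basis m e E \<longrightarrow>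
      (\<forall>v\<in>DG_space k \<T> E. \<exists>W3. \<forall>x\<in>closure \<Omega>.
         v x = of_coords m e (network m k (2 * H) (M * N_S) W b W0 W1 b2 W3 x))"
    by (elim exE)
  show ?thesis
  proof (intro conjI allI impI ballI)
    fix m and E :: "'e set" and e v
    assume "is_basis m e E" "v \<in> DG_space k \<T> E"
    then have "\<exists>W3. \<forall>x\<in>closure \<Omega>.
        v x = of_coords m e (network m k (2 * H) (M * N_S) W b W0 W1 b2 W3 x)"
      using hidden by simp
    then obtain W3 where W3: "\<forall>x\<in>closure \<Omega>.
        v x = of_coords m e (network m k (2 * H) (M * N_S) W b W0 W1 b2 W3 x)" ..
    show "\<exists>f\<in>NN m k (2 * H) (M * N_S). \<forall>x\<in>closure \<Omega>. v x = of_coords m e (f x)"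
    proof (rule bexI)
      show "network m k (2 * H) (M * N_S) W b W0 W1 b2 W3 \<in> NN m k (2 * H) (M * N_S)"
        unfolding NN_def by blast
    qed (rule W3)
  next
    show "\<exists>W\<^sub>I b\<^sub>I W\<^sub>0 W\<^sub>1 b\<^sub>I\<^sub>I. \<forall>m (E :: 'e set) b. 1 \<le> m \<longrightarrow> is_basis m b E \<longrightarrow>
        (\<forall>v\<in>DG_space k \<T> E. \<exists>W\<^sub>I\<^sub>I\<^sub>I. \<forall>x\<in>closure \<Omega>. v x = of_coords m b
          (network m k (2 * H) (M * N_S) W\<^sub>I b\<^sub>I W\<^sub>0 W\<^sub>1 b\<^sub>I\<^sub>I W\<^sub>I\<^sub>I\<^sub>I x))"
      by (rule exI[of _ W], rule exI[of _ b], rule exI[of _ W0], rule exI[of _ W1],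
          rule exI[of _ b2]) (use hidden in simp)
  next
    show "M * N_S \<le> M * (2 ^ (d + 1) - 1) * N_T"
      using card_subsimplices(2)[OF assms(2)] unfolding d_def N_S_def N_T_def
      by (simp only: mult.assoc mult_le_mono2)
  qed
qed

end
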